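(* Let $a,b$ be real numbers with $\min(a,b)\ge 2$, and put $\lambda:=1/a$, $\mu:=1/b$. For each integer $n\ge 1$, let $X_n$ be the number of intersections between the randomly thrown cluster $\mathcal{Z}_n$ of $n$ needles of length $1$ and the lattice of rectangles $\mathcal{R}_{a,b}$, divided by $n$, and let $F_n(x)=P(X_n\le x)$, $x\in\mathbb{R}$, be its distribution function. Then, as $n\to\infty$, the random variables $X_n$ converge weakly (in distribution) to the random variable $X$ whose distribution function is $$ F(x)=\begin{cases} 0 & \text{for } -\infty<x<0,\\ 1-2(\lambda+\mu)\cos(\pi x)+2\bigl(2\cos(\pi x)-\pi x\sin(\pi x)\bigr)\lambda\mu & \text{for } 0\le x<\tfrac12,\\ 1+2\pi(x-1)\lambda\mu\sin(\pi x) & \text{for } \tfrac12\le x<1,\\ 1 & \text{for } 1\le x<\infty. \end{cases} $$ Moreover, the convergence of the distribution functions is uniform: $$\lim_{n\to\infty}\ \sup_{x\in\mathbb{R}}|F_n(x)-F(x)|=0 .$$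
   Context: The lattice $\mathcal{R}_{a,b}$ is the plane lattice of rectangles with fundamental cell a rectangle of side lengths $a$ and $b$, i.e. the union of the vertical lines $\{(x,y)\in\mathbb{R}^2: x=ja\}$, $j\in\mathbb{Z}$, and the horizontal lines $\{(x,y)\in\mathbb{R}^2: y=jb\}$, $j\in\mathbb{Z}$. The cluster $\mathcal{Z}_n$ consists of $n$ needles (line segments), each of length $1$, each having one of its end points at a common point, the centre of $\mathcal{Z}_n$. A random throw of $\mathcal{Z}_n$ onto $\mathcal{R}_{a,b}$ is defined as follows: the coordinates $x$ and $y$ of the centre are random variables uniformly distributed in $[0,a]$ and $[0,b]$ respectively; for each $i\in\{1,\dots,n\}$ the angle $\phi_i$ between the $x$-axis and needle $i$ is a random variable uniformly distributed in $[0,2\pi]$; all $n+2$ random variables $x,y,\phi_1,\dots,\phi_n$ are stochastically independent. (Thus needle $i$ is the segment from $(x,y)$ to $(x+\cos\phi_i,\,y+\sin\phi_i)$.) The number of intersections between $\mathcal{Z}_n$ and $\mathcal{R}_{a,b}$ is the sum over the $n$ needles of the number of lattice lines (vertical and horizontal) met by that needle. Since $\min(a,b)\ge 2$, up to events of probability zero each needle meets at most one vertical and at most one horizontal line, so this number lies in $\{0,1,\dots,2n\}$ almost surely. With $p_n(i)$ the probability of exactly $i$ intersections, $F_n(x)=0$ for $x<0$, $F_n(x)=\sum_{i=0}^{\lfloor nx\rfloor}p_n(i)$ for $0\le x<2$, and $F_n(x)=1$ for $x\ge 2$. *)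

theory Defs
  imports "HOL-Probability.Probability"
begin

text \<open>The lattice is represented by its set of lines, because intersections are counted
  line by line.\<close>

definition vertical_line :: "real \<Rightarrow> int \<Rightarrow> (real \<times> real) set" where
  "vertical_line a j = {p. fst p = of_int j * a}"

definition horizontal_line :: "real \<Rightarrow> int \<Rightarrow> (real \<times> real) set" where
  "horizontal_line b j = {p. snd p = of_int j * b}"

definition lattice_lines :: "real \<Rightarrow> real \<Rightarrow> (real \<times> real) set set" where
  "lattice_lines a b = range (vertical_line a) \<union> range (horizontal_line b)"

definition needle :: "real \<times> real \<Rightarrow> real \<Rightarrow> (real \<times> real) set" where
  "needle c \<phi> = closed_segment c (c + (cos \<phi>, sin \<phi>))"

text \<open>For \<open>a, b > 0\<close> a needle meets only finitely many lines, so the cardinality below is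
  the true number of lines met.\<close>

definition needle_intersections :: "real \<Rightarrow> real \<Rightarrow> real \<times> real \<Rightarrow> real \<Rightarrow> nat" where
  "needle_intersections a b c \<phi> = card {L \<in> lattice_lines a b. needle c \<phi> \<inter> L \<noteq> {}}"

definition cluster_intersections ::
    "real \<Rightarrow> real \<Rightarrow> nat \<Rightarrow> real \<times> real \<Rightarrow> (nat \<Rightarrow> real) \<Rightarrow> nat" where
  "cluster_intersections a b n c \<phi> = (\<Sum>i\<in>{1..n}. needle_intersections a b c (\<phi> i))"

datatype coordinate = Abscissa | Ordinate | Angle nat

locale random_throw = prob_space M
  for M :: "'w measure" +
  fixes a b :: real and n :: nat
    and x y :: "'w \<Rightarrow> real" and \<phi> :: "nat \<Rightarrow> 'w \<Rightarrow> real"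
  assumes x_uniform: "distr M borel x = uniform_measure lborel {0..a}"
    and y_uniform: "distr M borel y = uniform_measure lborel {0..b}"
    and angle_uniform:
      "\<And>i. i \<in> {1..n} \<Longrightarrow> distr M borel (\<phi> i) = uniform_measure lborel {0..2 * pi}"
    and independent:
      "indep_vars (\<lambda>_. borel)
         (\<lambda>k. case k of Abscissa \<Rightarrow> x | Ordinate \<Rightarrow> y | Angle i \<Rightarrow> \<phi> i)
         ({Abscissa, Ordinate} \<union> Angle ` {1..n})"

definition relative_intersections ::
    "real \<Rightarrow> real \<Rightarrow> nat \<Rightarrow> ('w \<Rightarrow> real) \<Rightarrow> ('w \<Rightarrow> real) \<Rightarrow> (nat \<Rightarrow> 'w \<Rightarrow> real) \<Rightarrow> 'w \<Rightarrow> real" where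
  "relative_intersections a b n x y \<phi> \<omega> =
     real (cluster_intersections a b n (x \<omega>, y \<omega>) (\<lambda>i. \<phi> i \<omega>)) / real n"

definition limit_cdf :: "real \<Rightarrow> real \<Rightarrow> real \<Rightarrow> real" where
  "limit_cdf lam mu x =
     (if x < 0 then 0
      else if x < 1 / 2 then
        1 - 2 * (lam + mu) * cos (pi * x)
          + 2 * (2 * cos (pi * x) - pi * x * sin (pi * x)) * lam * mu
      else if x < 1 then 1 + 2 * pi * (x - 1) * lam * mu * sin (pi * x)
      else 1)"

end

theory Submission
  imports Defs
begin

text \<open>
  Given the centre \<open>(x, y)\<close> of the cluster, the needles are independent and identically distributed.
  By the law of large numbers the relative number of intersections is therefore close to its conditional
  mean, the expected number of lines met by one needle, which is \<open>hit_prob a x + hit_prob b y\<close>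
  (\<open>measure_crosses\<close>). The law of this random variable does not depend on \<open>n\<close>; it is the
  limit law.

  Quantitatively, the deviations of the single needles from the conditional mean are bounded and
  pairwise uncorrelated (\<open>deviations_uncorrelated\<close>), so that Chebyshev's inequality
  bounds the probability of a deviation of the average by \<open>e\<close> by \<open>4 / (n e^2)\<close>
  (\<open>prob_share_far_from_mean\<close>).

  The closed form of the limit distribution function (\<open>cdf_limit_distr\<close>) is a convolution: the two hitting
  probabilities are independent, and each has the distribution function \<open>1 - 2 cos (pi s) / c\<close>
  on \<open>[0, 1/2)\<close>, where \<open>c\<close> is the side of the cell, with an atom at \<open>0\<close> for the centres that are out of reach of
  all lines. The three cases of the formula arise because each summand lies in \<open>[0, 1/2]\<close>.

  The limit distribution function is continuous except for a possible jump at \<open>0\<close>. Convergence holds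
  there too, because a centre with vanishing conditional mean almost surely has no
  intersections at all (\<open>prob_share_eq_0_lower\<close>). Pointwise convergence everywhere, monotonicity and
  continuity on \<open>[0, 1]\<close> then give uniform convergence (\<open>uniform_convergence_of_monotone\<close>).
\<close>

section \<open>Lines met by a single needle\<close>

definition crosses :: "real \<Rightarrow> real \<Rightarrow> real \<Rightarrow> bool" where
  "crosses a x d \<longleftrightarrow> (\<exists>j::int. of_int j * a \<in> closed_segment x (x + d))"

text \<open>The probability that a needle of uniform direction crosses a line of one family, as a
  function of the coordinate \<open>x\<close> of the centre: a line at distance \<open>u \<le> 1\<close> is reached by the
  directions in an arc of half-angle \<open>arccos u\<close>. For \<open>x\<close> in \<open>[0, a]\<close> with \<open>a \<ge> 2\<close> only the nearer of
  the two adjacent lines is within reach, whence \<open>min x (a - x)\<close>. The clamp to \<open>[0, 1]\<close> keeps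
  \<open>arccos\<close> continuous on the whole line, and gives \<open>0\<close> when both lines are out of reach.\<close>

definition hit_prob :: "real \<Rightarrow> real \<Rightarrow> real" where
  "hit_prob a x = arccos (max 0 (min 1 (min x (a - x)))) / pi"

text \<open>Consecutive lines of a family are at least twice the needle length apart, so that counting lines
  within one family reduces to a yes/no question.\<close>

lemma card_multiples_in_short_segment:
  fixes a x d :: real
  assumes "2 \<le> a" "\<bar>d\<bar> \<le> 1"
  shows "card {j::int. of_int j * a \<in> closed_segment x (x + d)} = of_bool (crosses a x d)"
proof -
  have uniq: "j = k" if "of_int j * a \<in> closed_segment x (x + d)" "of_int k * a \<in> closed_segment x (x + d)"
    for j k :: int
  proof (rule ccontr)
    assume "j \<noteq> k"
    then have "1 \<le> \<bar>j - k\<bar>" by linarith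
    then have "1 \<le> \<bar>real_of_int j - real_of_int k\<bar>" by (metis of_int_1_le_iff of_int_abs of_int_diff)
    then have "a \<le> \<bar>real_of_int j - real_of_int k\<bar> * a" using assms by simp
    also have "\<dots> = \<bar>of_int j * a - of_int k * a\<bar>"
      using assms by (simp add: abs_mult flip: left_diff_distrib)
    also have "\<dots> \<le> 1"
      using that assms by (auto simp: closed_segment_eq_real_ivl split: if_splits)
    finally show False using assms by simp
  qed
  show ?thesis
  proof (cases "crosses a x d")
    case True
    then obtain j :: int where "of_int j * a \<in> closed_segment x (x + d)" by (auto simp: crosses_def)
    with uniq have "{j::int. of_int j * a \<in> closed_segment x (x + d)} = {j}" by blast
    with True show ?thesis by simp
  next
    case False
    then show ?thesis by (auto simp: crosses_def)
  qed
qed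

lemma needle_eq: "needle (x, y) \<phi> = (\<lambda>u. (x + u * cos \<phi>, y + u * sin \<phi>)) ` {0..1}"
  by (auto simp: needle_def closed_segment_def image_def algebra_simps)

lemma needle_meets_vertical_line:
  "needle (x, y) \<phi> \<inter> vertical_line a j \<noteq> {} \<longleftrightarrow> of_int j * a \<in> closed_segment x (x + cos \<phi>)"
proof -
  have "A \<inter> B \<noteq> {} \<longleftrightarrow> (\<exists>p\<in>A. p \<in> B)" for A B :: "(real \<times> real) set"
    by blast
  then show ?thesis
    unfolding needle_eq vertical_line_def closed_segment_def by (auto simp: algebra_simps, metis)
qed

lemma needle_meets_horizontal_line:
  "needle (x, y) \<phi> \<inter> horizontal_line b j \<noteq> {} \<longleftrightarrow> of_int j * b \<in> closed_segment y (y + sin \<phi>)"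
proof -
  have "A \<inter> B \<noteq> {} \<longleftrightarrow> (\<exists>p\<in>A. p \<in> B)" for A B :: "(real \<times> real) set"
    by blast
  then show ?thesis
    unfolding needle_eq horizontal_line_def closed_segment_def by (auto simp: algebra_simps, metis)
qed

lemma needle_intersections_eq:
  assumes "2 \<le> a" "2 \<le> b"
  shows "needle_intersections a b (x, y) \<phi> = of_bool (crosses a x (cos \<phi>)) + of_bool (crosses b y (sin \<phi>))"
proof -
  let ?V = "{j. of_int j * a \<in> closed_segment x (x + cos \<phi>)}"
  let ?H = "{j. of_int j * b \<in> closed_segment y (y + sin \<phi>)}"
  have V: "card ?V = of_bool (crosses a x (cos \<phi>))" and H: "card ?H = of_bool (crosses b y (sin \<phi>))"
    by (intro card_multiples_in_short_segment assms abs_cos_le_one abs_sin_le_one)+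
  have fin: "finite {j::int. of_int j * c \<in> closed_segment z (z + d)}" if "2 \<le> c" for c z d :: real
  proof (rule finite_subset)
    show "{j::int. of_int j * c \<in> closed_segment z (z + d)} \<subseteq> {\<lfloor>min z (z + d) / c\<rfloor>..\<lceil>max z (z + d) / c\<rceil>}"
    proof safe
      fix j :: int assume "of_int j * c \<in> closed_segment z (z + d)"
      then have "min z (z + d) / c \<le> of_int j" "of_int j \<le> max z (z + d) / c"
        using that by (auto simp: closed_segment_eq_real_ivl field_simps split: if_splits)
      then show "j \<in> {\<lfloor>min z (z + d) / c\<rfloor>..\<lceil>max z (z + d) / c\<rceil>}" by (simp; linarith)
    qed
  qed simp
  have injV: "inj (vertical_line a)"
  proof
    fix j k assume eq: "vertical_line a j = vertical_line a k"
    have "(of_int j * a, 0) \<in> vertical_line a j" by (simp add: vertical_line_def)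
    then have "(of_int j * a, 0) \<in> vertical_line a k" by (simp only: eq)
    then show "j = k" using assms by (simp add: vertical_line_def)
  qed
  have injH: "inj (horizontal_line b)"
  proof
    fix j k assume eq: "horizontal_line b j = horizontal_line b k"
    have "(0, of_int j * b) \<in> horizontal_line b j" by (simp add: horizontal_line_def)
    then have "(0, of_int j * b) \<in> horizontal_line b k" by (simp only: eq)
    then show "j = k" using assms by (simp add: horizontal_line_def)
  qed
  have ne: "vertical_line a j \<noteq> horizontal_line b k" for j k
  proof
    assume "vertical_line a j = horizontal_line b k"
    moreover have "(of_int j * a, of_int k * b + 1) \<in> vertical_line a j" by (simp add: vertical_line_def)
    ultimately show False by (simp add: horizontal_line_def)
  qed
  have cV: "card (vertical_line a ` ?V) = card ?V"
    by (rule card_image[OF inj_on_subset[OF injV subset_UNIV]])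
  have cH: "card (horizontal_line b ` ?H) = card ?H"
    by (rule card_image[OF inj_on_subset[OF injH subset_UNIV]])
  have hit_lines: "{L \<in> range f \<union> range g. P L} = f ` {j. P (f j)} \<union> g ` {j. P (g j)}"
    for f g :: "int \<Rightarrow> (real \<times> real) set" and P
    by auto
  have lines: "{L \<in> lattice_lines a b. needle (x, y) \<phi> \<inter> L \<noteq> {}} = vertical_line a ` ?V \<union> horizontal_line b ` ?H"
    unfolding lattice_lines_def hit_lines needle_meets_vertical_line needle_meets_horizontal_line
    by (rule refl)
  have "card (vertical_line a ` ?V \<union> horizontal_line b ` ?H) = card (vertical_line a ` ?V) + card (horizontal_line b ` ?H)"
  proof (rule card_Un_disjoint)
    show "vertical_line a ` ?V \<inter> horizontal_line b ` ?H = {}" using ne by blast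
  qed (intro finite_imageI fin assms)+
  then show ?thesis by (simp only: needle_intersections_def lines cV cH V H)
qed

lemma crosses_iff:
  assumes "2 \<le> a" "0 < x" "x < a" "\<bar>d\<bar> \<le> 1"
  shows "crosses a x d \<longleftrightarrow> d \<le> - x \<or> a - x \<le> d"
proof
  assume "crosses a x d"
  then obtain j :: int where j: "of_int j * a \<in> closed_segment x (x + d)" by (auto simp: crosses_def)
  then have bounds: "min x (x + d) \<le> of_int j * a" "of_int j * a \<le> max x (x + d)"
    by (auto simp: closed_segment_eq_real_ivl split: if_splits)
  consider "j \<le> -1" | "j = 0" | "j = 1" | "2 \<le> j" by linarith
  then show "d \<le> - x \<or> a - x \<le> d"
  proof cases
    case 1
    then have "real_of_int j * a \<le> -1 * a" using assms by (intro mult_right_mono) auto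
    then show ?thesis using bounds assms by linarith
  next
    case 4
    then have "2 * a \<le> real_of_int j * a" using assms by (intro mult_right_mono) auto
    then show ?thesis using bounds assms by linarith
  qed (use j assms in \<open>auto simp: closed_segment_eq_real_ivl split: if_splits\<close>)
next
  assume "d \<le> - x \<or> a - x \<le> d"
  then have "of_int 0 * a \<in> closed_segment x (x + d) \<or> of_int 1 * a \<in> closed_segment x (x + d)"
    using assms by (auto simp: closed_segment_eq_real_ivl)
  then show "crosses a x d" unfolding crosses_def by blast
qed

text \<open>Quantifying over all integers \<open>j\<close>, rather than over the two lines next to the centre, makes the
  event measurable without any restriction of the centre to the fundamental cell.\<close>

lemma crosses_measurable [measurable]:
  assumes [measurable]: "f \<in> borel_measurable M" "g \<in> borel_measurable M"
  shows "Measurable.pred M (\<lambda>w. crosses a (f w) (g w))"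
proof -
  have "crosses a x d \<longleftrightarrow>
      (\<exists>j::int. x \<le> of_int j * a \<and> of_int j * a \<le> x + d \<or> x + d \<le> of_int j * a \<and> of_int j * a \<le> x)" for x d
    unfolding crosses_def by (rule ex_cong1) (auto simp: closed_segment_eq_real_ivl)
  then show ?thesis by simp
qed

lemma hit_prob_measurable [measurable]: "hit_prob a \<in> borel_measurable borel"
  unfolding hit_prob_def [abs_def]
  by (intro borel_measurable_continuous_onI continuous_intros) auto

lemma hit_prob_bounds: "0 \<le> hit_prob a x" "hit_prob a x \<le> 1 / 2"
proof -
  let ?u = "max 0 (min 1 (min x (a - x)))"
  have "0 \<le> arccos ?u" by (intro arccos_lbound) auto
  moreover have "arccos ?u \<le> pi / 2" by (intro arccos_le_pi2) auto
  ultimately show "0 \<le> hit_prob a x" "hit_prob a x \<le> 1 / 2"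
    by (simp_all add: hit_prob_def field_simps)
qed

section \<open>Arcs of directions\<close>

lemma le_cos_iff:
  assumes "\<bar>t\<bar> \<le> pi" "\<bar>c\<bar> \<le> 1"
  shows "c \<le> cos t \<longleftrightarrow> \<bar>t\<bar> \<le> arccos c"
proof -
  have "c \<le> cos t \<longleftrightarrow> arccos (cos \<bar>t\<bar>) \<le> arccos c"
    using assms by (subst arccos_le_mono) auto
  then show ?thesis using assms by (simp add: arccos_cos del: cos_abs_real)
qed

text \<open>The four directions of the axes are alike: each event is a symmetric arc of half-angle
  \<open>arccos c\<close> around one of them, empty for \<open>c > 1\<close>. In the coordinate \<open>[0, 2 pi]\<close> only the arc around
  \<open>0\<close> is split into two intervals.\<close>

lemma measure_arcs:
  assumes "0 < c"
  shows "measure (uniform_measure lborel {0..2 * pi}) {\<phi>. c \<le> cos \<phi>} = arccos (min 1 c) / pi"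
    and "measure (uniform_measure lborel {0..2 * pi}) {\<phi>. cos \<phi> \<le> - c} = arccos (min 1 c) / pi"
    and "measure (uniform_measure lborel {0..2 * pi}) {\<phi>. c \<le> sin \<phi>} = arccos (min 1 c) / pi"
    and "measure (uniform_measure lborel {0..2 * pi}) {\<phi>. sin \<phi> \<le> - c} = arccos (min 1 c) / pi"
proof -
  define A where "A = arccos (min 1 c)"
  have A: "0 \<le> A" "A \<le> pi / 2"
    using arccos_lbound[of "min 1 c"] arccos_le_pi2[of "min 1 c"] assms by (auto simp: A_def)
  have Alt: "A < pi / 2"
    using assms arccos_less_arccos[of 0 "min 1 c"] by (auto simp: A_def)
  have U: "measure (uniform_measure lborel {0..2 * pi}) B = measure lborel ({0..2 * pi} \<inter> B) / (2 * pi)"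
    if "B \<in> sets borel" for B
    using that by (subst measure_uniform_measure) auto
  have iff: "c \<le> cos t \<longleftrightarrow> \<bar>t\<bar> \<le> A \<and> c \<le> 1" if "\<bar>t\<bar> \<le> pi" for t
  proof (cases "c \<le> 1")
    case True
    then show ?thesis using le_cos_iff[OF that, of c] assms by (simp add: A_def)
  next
    case False
    then show ?thesis using cos_le_one[of t] by linarith
  qed
  have A0: "A = 0" if "\<not> c \<le> 1" using that by (simp add: A_def)
  have unsplit_arc: "measure (uniform_measure lborel {0..2 * pi}) {\<phi>. P \<phi>} = A / pi"
    if "\<And>t. 0 \<le> t \<Longrightarrow> t \<le> 2 * pi \<Longrightarrow> P t \<longleftrightarrow> \<bar>t - m\<bar> \<le> A \<and> c \<le> 1"
      "pi / 2 \<le> m" "m \<le> 3 * pi / 2" "{\<phi>. P \<phi>} \<in> sets borel" for P m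
  proof (cases "c \<le> 1")
    case True
    then have "{0..2 * pi} \<inter> {\<phi>. P \<phi>} = {m - A..m + A}"
      using that A by (auto simp: abs_le_iff)
    then show ?thesis using that A by (simp add: U)
  next
    case False
    then have "{0..2 * pi} \<inter> {\<phi>. P \<phi>} = {}"
      using that by auto
    then show ?thesis using that A0 False by (simp add: U)
  qed
  show "measure (uniform_measure lborel {0..2 * pi}) {\<phi>. c \<le> cos \<phi>} = arccos (min 1 c) / pi"
  proof (cases "c \<le> 1")
    case True
    have "c \<le> cos t \<longleftrightarrow> t \<le> A \<or> 2 * pi - A \<le> t" if "0 \<le> t" "t \<le> 2 * pi" for t
    proof (cases "t \<le> pi")
      case True
      then show ?thesis using iff[of t] that \<open>c \<le> 1\<close> Alt by auto
    next
      case False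
      have "cos (2 * pi - t) = cos t" by (simp add: cos_diff)
      then show ?thesis using iff[of "2 * pi - t"] that \<open>c \<le> 1\<close> Alt False by auto
    qed
    then have "{0..2 * pi} \<inter> {\<phi>. c \<le> cos \<phi>} = {0..A} \<union> {2 * pi - A..2 * pi}"
      using A by auto
    also have "measure lborel \<dots> = measure lborel {0..A} + measure lborel {2 * pi - A..2 * pi}"
      using A Alt by (intro measure_Union) auto
    finally show ?thesis using A by (subst U) (auto simp: A_def)
  next
    case False
    then have "\<not> c \<le> cos t" for t using cos_le_one[of t] by linarith
    then show ?thesis using A0 False by (simp add: A_def)
  qed
  have "measure (uniform_measure lborel {0..2 * pi}) {\<phi>. cos \<phi> \<le> - c} = A / pi"
  proof (rule unsplit_arc[where m = pi])
    fix t :: real assume "0 \<le> t" "t \<le> 2 * pi"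
    moreover have "cos (t - pi) = - cos t" by (simp add: cos_diff)
    ultimately show "cos t \<le> - c \<longleftrightarrow> \<bar>t - pi\<bar> \<le> A \<and> c \<le> 1"
      using iff[of "t - pi"] by (auto simp: abs_le_iff)
  qed auto
  then show "measure (uniform_measure lborel {0..2 * pi}) {\<phi>. cos \<phi> \<le> - c} = arccos (min 1 c) / pi"
    by (simp add: A_def)
  have "measure (uniform_measure lborel {0..2 * pi}) {\<phi>. c \<le> sin \<phi>} = A / pi"
  proof (rule unsplit_arc[where m = "pi / 2"])
    fix t :: real assume t: "0 \<le> t" "t \<le> 2 * pi"
    show "c \<le> sin t \<longleftrightarrow> \<bar>t - pi / 2\<bar> \<le> A \<and> c \<le> 1"
    proof (cases "t \<le> pi")
      case True
      have "cos (t - pi / 2) = sin t" by (simp add: cos_diff)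
      then show ?thesis using iff[of "t - pi / 2"] t True by (auto simp: abs_le_iff)
    next
      case False
      then have "sin t \<le> 0" using sin_ge_zero[of "t - pi"] t by (simp add: sin_diff)
      then show ?thesis using assms False Alt by auto
    qed
  qed auto
  then show "measure (uniform_measure lborel {0..2 * pi}) {\<phi>. c \<le> sin \<phi>} = arccos (min 1 c) / pi"
    by (simp add: A_def)
  have "measure (uniform_measure lborel {0..2 * pi}) {\<phi>. sin \<phi> \<le> - c} = A / pi"
  proof (rule unsplit_arc[where m = "3 * pi / 2"])
    fix t :: real assume t: "0 \<le> t" "t \<le> 2 * pi"
    show "sin t \<le> - c \<longleftrightarrow> \<bar>t - 3 * pi / 2\<bar> \<le> A \<and> c \<le> 1"
    proof (cases "pi \<le> t")
      case True
      have "t - 3 * pi / 2 = (t - pi) - pi / 2" by simp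
      then have "cos (t - 3 * pi / 2) = sin (t - pi)" by (simp only: cos_diff) simp
      also have "\<dots> = - sin t" by (simp add: sin_diff)
      finally have "sin t \<le> - c \<longleftrightarrow> c \<le> cos (t - 3 * pi / 2)" by linarith
      also have "\<dots> \<longleftrightarrow> \<bar>t - 3 * pi / 2\<bar> \<le> A \<and> c \<le> 1"
        using t True by (intro iff) (simp add: abs_le_iff)
      finally show ?thesis .
    next
      case False
      then have "0 \<le> sin t" using t by (intro sin_ge_zero) auto
      then have "\<not> sin t \<le> - c" using assms by linarith
      moreover have "\<not> \<bar>t - 3 * pi / 2\<bar> \<le> A" using False Alt by linarith
      ultimately show ?thesis by blast
    qed
  qed auto
  then show "measure (uniform_measure lborel {0..2 * pi}) {\<phi>. sin \<phi> \<le> - c} = arccos (min 1 c) / pi"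
    by (simp add: A_def)
qed

text \<open>The point \<open>x = 1\<close> is left out because for \<open>a = 2\<close> both neighbouring lines are then touched,
  each by a single direction; elsewhere at most one line of the family is within reach.
  The function \<open>f\<close> stands for the cosine or the sine, so that one argument serves both families.\<close>

lemma measure_crosses:
  assumes "2 \<le> a" "0 < x" "x < a" "x \<noteq> 1"
    and f: "\<And>t. \<bar>f t\<bar> \<le> 1"
    and arcs: "\<And>c. 0 < c \<Longrightarrow> measure U {t. c \<le> f t} = arccos (min 1 c) / pi"
      "\<And>c. 0 < c \<Longrightarrow> measure U {t. f t \<le> - c} = arccos (min 1 c) / pi"
  shows "measure U {t. crosses a x (f t)} = hit_prob a x"
proof -
  have iff: "crosses a x (f t) \<longleftrightarrow> f t \<le> - x \<or> a - x \<le> f t" for t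
    using assms by (intro crosses_iff) auto
  show ?thesis
  proof (cases "x < 1")
    case True
    have not: "\<not> a - x \<le> f t" for t using True assms(1) f[of t] by linarith
    have "{t. crosses a x (f t)} = {t. f t \<le> - x}"
      using not by (simp add: iff)
    moreover have "max 0 (min 1 (min x (a - x))) = min 1 x" using True assms by auto
    ultimately show ?thesis using arcs(2)[of x] assms by (simp add: hit_prob_def)
  next
    case False
    have not: "\<not> f t \<le> - x" for t using False assms(4) f[of t] by linarith
    have "{t. crosses a x (f t)} = {t. a - x \<le> f t}"
      using not by (simp add: iff)
    moreover have "max 0 (min 1 (min x (a - x))) = min 1 (a - x)" using False assms by auto
    ultimately show ?thesis using arcs(1)[of "a - x"] assms by (simp add: hit_prob_def)
  qed
qed

section \<open>The limit law\<close>

text \<open>The distribution function of the hitting probability of one family, for a centre uniform in a cell of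
  side \<open>1 / mu\<close>: see \<open>measure_hit_prob_le\<close>.\<close>

definition axis_cdf :: "real \<Rightarrow> real \<Rightarrow> real" where
  "axis_cdf mu s = (if s < 0 then 0 else if s < 1 / 2 then 1 - 2 * mu * cos (pi * s) else 1)"

lemma axis_cdf_simps:
  "s < 0 \<Longrightarrow> axis_cdf mu s = 0"
  "0 \<le> s \<Longrightarrow> s < 1 / 2 \<Longrightarrow> axis_cdf mu s = 1 - 2 * mu * cos (pi * s)"
  "1 / 2 \<le> s \<Longrightarrow> axis_cdf mu s = 1"
  by (simp_all add: axis_cdf_def)

lemma axis_cdf_measurable [measurable]: "axis_cdf mu \<in> borel_measurable borel"
  unfolding axis_cdf_def [abs_def] by measurable

lemma axis_cdf_nonneg:
  assumes "0 \<le> mu" "mu \<le> 1 / 2"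
  shows "0 \<le> axis_cdf mu s"
proof -
  have "mu * cos (pi * s) \<le> mu * 1" using assms by (intro mult_left_mono) auto
  then show ?thesis using assms by (auto simp: axis_cdf_def)
qed

lemma arccos_over_pi_le_iff:
  assumes "0 \<le> s" "s \<le> 1" "0 \<le> u" "u \<le> 1"
  shows "arccos u / pi \<le> s \<longleftrightarrow> cos (pi * s) \<le> u"
proof -
  have "arccos u / pi \<le> s \<longleftrightarrow> arccos u \<le> arccos (cos (pi * s))"
    using assms by (simp add: arccos_cos field_simps)
  also have "\<dots> \<longleftrightarrow> cos (pi * s) \<le> u"
    using assms by (subst arccos_le_mono) auto
  finally show ?thesis .
qed

lemma measure_hit_prob_le:
  assumes "2 \<le> a"
  shows "measure (uniform_measure lborel {0..a}) {x. hit_prob a x \<le> s} = axis_cdf (1 / a) s"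
proof -
  have [measurable]: "{x. hit_prob a x \<le> s} \<in> sets borel" by measurable
  have U: "measure (uniform_measure lborel {0..a}) {x. hit_prob a x \<le> s}
      = measure lborel ({0..a} \<inter> {x. hit_prob a x \<le> s}) / a"
    using assms by (subst measure_uniform_measure) auto
  consider "s < 0" | "0 \<le> s" "s < 1 / 2" | "1 / 2 \<le> s" by linarith
  then show ?thesis
  proof cases
    case 1
    then have "\<not> hit_prob a x \<le> s" for x using hit_prob_bounds(1)[of a x] by linarith
    then show ?thesis using 1 by (simp add: U axis_cdf_def)
  next
    case 3
    then have "hit_prob a x \<le> s" for x using hit_prob_bounds(2)[of a x] by linarith
    then show ?thesis using 3 assms U by (simp add: axis_cdf_def)
  next
    case 2
    let ?c = "cos (pi * s)"
    have s: "0 \<le> pi * s" "pi * s < pi / 2" using 2 by (auto simp: field_simps)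
    have "0 < ?c" by (rule cos_gt_zero_pi) (use s in linarith)+
    then have c: "0 < ?c" "?c \<le> 1" by auto
    have iff: "hit_prob a x \<le> s \<longleftrightarrow> ?c \<le> x \<and> x \<le> a - ?c" for x
    proof -
      let ?u = "max 0 (min 1 (min x (a - x)))"
      have "hit_prob a x \<le> s \<longleftrightarrow> ?c \<le> ?u"
        unfolding hit_prob_def using 2 by (intro arccos_over_pi_le_iff) auto
      also have "\<dots> \<longleftrightarrow> ?c \<le> x \<and> x \<le> a - ?c" using c by auto
      finally show ?thesis .
    qed
    have "{x. hit_prob a x \<le> s} = {?c..a - ?c}"
      by (rule set_eqI) (simp only: iff mem_Collect_eq atLeastAtMost_iff)
    then have "{0..a} \<inter> {x. hit_prob a x \<le> s} = {?c..a - ?c}" using c by auto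
    moreover have "?c \<le> a - ?c" using c assms by linarith
    then have "measure lborel {?c..a - ?c} = a - 2 * ?c" by simp
    moreover have "(a - 2 * ?c) / a = 1 - 2 * (1 / a) * ?c" using assms by (simp add: diff_divide_distrib)
    ultimately show ?thesis using 2 by (simp only: U axis_cdf_simps)
  qed
qed

text \<open>The value of the integral of \<open>axis_cdf mu (t - arccos u / pi)\<close> over \<open>u\<close> in \<open>[0, 1]\<close>, that is, the
  contribution to the convolution of the two axis laws of centres within distance \<open>1\<close> of one fixed line.\<close>

definition edge_integral :: "real \<Rightarrow> real \<Rightarrow> real" where
  "edge_integral mu t =
     (if t < 0 then 0
      else if t < 1 / 2 then 1 - cos (pi * t) - mu * pi * t * sin (pi * t)
      else if t < 1 then 1 - mu * pi * (1 - t) * sin (pi * t)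
      else 1)"

text \<open>The addition theorem turns the integrand into \<open>cos (pi t) u + sin (pi t) sqrt (1 - u^2)\<close>, which has an
  elementary antiderivative. The derivative of \<open>arccos\<close> is singular at \<open>1\<close>, so the fundamental theorem is
  used in the form that asks for differentiability in the interior only.\<close>

lemma has_integral_cos_diff_arccos:
  fixes t mu p q :: real
  assumes "0 \<le> p" "p \<le> q" "q \<le> 1"
  defines "W \<equiv> \<lambda>u. u - 2 * mu * (cos (pi * t) * u\<^sup>2 / 2 + sin (pi * t) * (u * sqrt (1 - u\<^sup>2) - arccos u) / 2)"
  shows "((\<lambda>u. 1 - 2 * mu * cos (pi * (t - arccos u / pi))) has_integral W q - W p) {p..q}"
proof (rule fundamental_theorem_of_calculus_interior)
  show "continuous_on {p..q} W"
    unfolding W_def using assms by (intro continuous_intros) auto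
  fix u assume u: "u \<in> {p<..<q}"
  with assms have u01: "0 < u" "u < 1" by auto
  then have pos: "0 < 1 - u\<^sup>2" by (simp add: power_less_one_iff)
  let ?r = "sqrt (1 - u\<^sup>2)"
  have r: "0 < ?r" "?r * ?r = 1 - u\<^sup>2" using pos by auto
  define V where "V u = u * sqrt (1 - u\<^sup>2) - arccos u" for u :: real
  have V: "(V has_real_derivative 2 * ?r) (at u)"
  proof -
    have "(V has_real_derivative ?r + u * (- (2 * u) * (inverse ?r / 2)) - inverse (- ?r)) (at u)"
      unfolding V_def using u01 pos by (auto intro!: derivative_eq_intros)
    also have "?r + u * (- (2 * u) * (inverse ?r / 2)) - inverse (- ?r) = 2 * ?r"
      using r by (simp add: field_simps power2_eq_square)
    finally show ?thesis .
  qed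
  have W: "W = (\<lambda>u. u - 2 * mu * (cos (pi * t) * u\<^sup>2 / 2 + sin (pi * t) * V u / 2))"
    by (simp add: W_def V_def)
  have "pi * (t - arccos u / pi) = pi * t - arccos u" by (simp add: right_diff_distrib)
  then have "cos (pi * (t - arccos u / pi)) = cos (pi * t) * u + sin (pi * t) * ?r"
    using u01 by (simp add: cos_diff sin_arccos)
  moreover have "(W has_real_derivative
      1 - 2 * mu * (cos (pi * t) * (2 * u) / 2 + sin (pi * t) * (2 * ?r) / 2)) (at u)"
    unfolding W by (auto intro!: derivative_eq_intros V)
  ultimately show "(W has_vector_derivative 1 - 2 * mu * cos (pi * (t - arccos u / pi))) (at u)"
    by (simp add: has_real_derivative_iff_has_vector_derivative)
qed fact

text \<open>As \<open>u\<close> runs through \<open>[0, 1]\<close>, the argument \<open>t - arccos u / pi\<close> increases from \<open>t - 1/2\<close> to \<open>t\<close>.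
  For \<open>0 \<le> t < 1/2\<close> it enters the support of \<open>axis_cdf\<close> at \<open>u = cos (pi t)\<close>, and for
  \<open>1/2 \<le> t < 1\<close> it reaches the value \<open>1/2\<close>, from which on the integrand is \<open>1\<close>, at \<open>u = sin (pi t)\<close>.\<close>

lemma has_integral_axis_cdf_arccos:
  "((\<lambda>u. axis_cdf mu (t - arccos u / pi)) has_integral edge_integral mu t) {0..1}"
proof -
  have arccos01: "0 \<le> arccos u / pi" "arccos u / pi \<le> 1 / 2" if "0 \<le> u" "u \<le> 1" for u
    using that arccos_lbound[of u] arccos_le_pi2[of u] by (auto simp: field_simps)
  let ?f = "\<lambda>u. axis_cdf mu (t - arccos u / pi)"
  let ?g = "\<lambda>u. 1 - 2 * mu * cos (pi * (t - arccos u / pi))"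
  let ?c = "cos (pi * t)" and ?s = "sin (pi * t)"
  consider "t < 0" | "0 \<le> t" "t < 1 / 2" | "1 / 2 \<le> t" "t < 1" | "1 \<le> t" by linarith
  then show ?thesis
  proof cases
    case 1
    show ?thesis
    proof (rule has_integral_eq)
      fix u :: real assume "u \<in> {0..1}"
      then have u: "0 \<le> u" "u \<le> 1" by auto
      show "0 = ?f u" using arccos01[OF u] 1 by (intro axis_cdf_simps(1)[symmetric]) linarith
    next
      show "((\<lambda>u. 0) has_integral edge_integral mu t) {0..1::real}"
        using 1 by (simp add: edge_integral_def)
    qed
  next
    case 4
    show ?thesis
    proof (rule has_integral_eq)
      fix u :: real assume "u \<in> {0..1}"
      then have u: "0 \<le> u" "u \<le> 1" by auto
      show "1 = ?f u" using arccos01[OF u] 4 by (intro axis_cdf_simps(3)[symmetric]) linarith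
    next
      show "((\<lambda>u. 1) has_integral edge_integral mu t) {0..1::real}"
        using 4 has_integral_const_real[of "1::real" 0 1] by (simp add: edge_integral_def)
    qed
  next
    case 2
    have ang: "0 \<le> pi * t" "pi * t < pi / 2" using 2 by (auto simp: field_simps)
    have c0: "0 < ?c" by (rule cos_gt_zero_pi) (use ang in linarith)+
    have c1: "?c \<le> 1" by simp
    have s0: "0 \<le> ?s" by (rule sin_ge_zero) (use ang in linarith)+
    have iff: "arccos u / pi \<le> t \<longleftrightarrow> ?c \<le> u" if "0 \<le> u" "u \<le> 1" for u
      using that 2 by (intro arccos_over_pi_le_iff) auto
    have low: "(?f has_integral 0) {0..?c}"
    proof (rule has_integral_spike_finite)
      fix u assume "u \<in> {0..?c} - {?c}"
      then have "0 \<le> u" "\<not> ?c \<le> u" by auto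
      with c1 have u: "0 \<le> u" "u \<le> 1" "\<not> ?c \<le> u" by linarith+
      show "?f u = 0" using iff[OF u(1,2)] u(3) by (intro axis_cdf_simps(1)) linarith
    qed auto
    have high: "(?f has_integral edge_integral mu t) {?c..1}"
    proof (rule has_integral_eq)
      fix u assume "u \<in> {?c..1}"
      then have u: "0 \<le> u" "u \<le> 1" "?c \<le> u" using c0 by auto
      show "?g u = ?f u"
        using iff[OF u(1,2)] u(3) arccos01[OF u(1,2)] 2 by (intro axis_cdf_simps(2)[symmetric]) linarith+
    next
      have sc: "1 - ?c\<^sup>2 = ?s\<^sup>2" by (simp add: sin_squared_eq)
      have "sqrt (1 - ?c\<^sup>2) = ?s" using s0 by (simp add: sc)
      moreover have "arccos ?c = pi * t" by (rule arccos_cos) (use ang in linarith)+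
      ultimately have "(?g has_integral 1 - 2 * mu * (?c / 2)
          - (?c - 2 * mu * (?c * ?c\<^sup>2 / 2 + ?s * (?c * ?s - pi * t) / 2))) {?c..1}"
        using has_integral_cos_diff_arccos[of ?c 1 mu t] c0 by simp
      also have "1 - 2 * mu * (?c / 2)
          - (?c - 2 * mu * (?c * ?c\<^sup>2 / 2 + ?s * (?c * ?s - pi * t) / 2))
        = 1 - ?c - mu * (?c * (1 - ?c\<^sup>2) - ?s * (?c * ?s - pi * t))"
        by (simp add: field_simps)
      also have "\<dots> = edge_integral mu t"
        using 2 unfolding sc by (simp add: edge_integral_def algebra_simps power2_eq_square)
      finally show "(?g has_integral edge_integral mu t) {?c..1}" .
    qed
    show ?thesis using has_integral_combine[OF _ _ low high] c0 by simp
  next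
    case 3
    have ang: "pi / 2 \<le> pi * t" "pi * t < pi" using 3 by (auto simp: field_simps)
    have eq: "?s = cos (pi * (t - 1 / 2))" by (simp add: cos_diff right_diff_distrib)
    have s0: "0 \<le> ?s" by (rule sin_ge_zero) (use ang in linarith)+
    have s1: "?s \<le> 1" by simp
    have "0 \<le> sin (pi * t - pi / 2)" by (rule sin_ge_zero) (use ang in linarith)+
    then have c0: "?c \<le> 0" by (simp add: sin_diff)
    have iff: "arccos u / pi \<le> t - 1 / 2 \<longleftrightarrow> ?s \<le> u" if "0 \<le> u" "u \<le> 1" for u
      unfolding eq using that 3 by (intro arccos_over_pi_le_iff) auto
    have low: "(?f has_integral edge_integral mu t - (1 - ?s)) {0..?s}"
    proof (rule has_integral_spike_finite)
      fix u assume "u \<in> {0..?s} - {?s}"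
      then have "0 \<le> u" "\<not> ?s \<le> u" by auto
      with s1 have u: "0 \<le> u" "u \<le> 1" "\<not> ?s \<le> u" by linarith+
      show "?f u = ?g u"
        using iff[OF u(1,2)] u(3) arccos01[OF u(1,2)] 3 by (intro axis_cdf_simps(2)) linarith+
    next
      show "finite {?s}" by simp
      have "arccos (cos (pi * (t - 1 / 2))) = pi * (t - 1 / 2)"
        by (rule arccos_cos) (use 3 in \<open>auto simp: field_simps\<close>)
      then have "arccos ?s = pi * (t - 1 / 2)" by (simp only: eq)
      moreover have "1 - ?s\<^sup>2 = (- ?c)\<^sup>2" by (simp add: cos_squared_eq)
      then have "sqrt (1 - ?s\<^sup>2) = - ?c" using c0 by (simp only: real_sqrt_abs)
      ultimately have "(?g has_integral ?s - 2 * mu * (?c * ?s\<^sup>2 / 2 + ?s * (?s * - ?c - pi * (t - 1 / 2)) / 2)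
          - (0 - 2 * mu * (?s * (0 - pi / 2) / 2))) {0..?s}"
        using has_integral_cos_diff_arccos[of 0 ?s mu t] s0 by simp
      also have "?s - 2 * mu * (?c * ?s\<^sup>2 / 2 + ?s * (?s * - ?c - pi * (t - 1 / 2)) / 2)
          - (0 - 2 * mu * (?s * (0 - pi / 2) / 2)) = edge_integral mu t - (1 - ?s)"
        using 3 by (simp add: edge_integral_def field_simps power2_eq_square)
      finally show "(?g has_integral edge_integral mu t - (1 - ?s)) {0..?s}" .
    qed
    have high: "(?f has_integral 1 - ?s) {?s..1}"
    proof (rule has_integral_eq)
      fix u assume "u \<in> {?s..1}"
      then have u: "0 \<le> u" "u \<le> 1" "?s \<le> u" using s0 by auto
      show "1 = ?f u" using iff[OF u(1,2)] u(3) by (intro axis_cdf_simps(3)[symmetric]) linarith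
    next
      show "((\<lambda>u. 1) has_integral 1 - ?s) {?s..1}"
        using has_integral_const_real[of "1::real" ?s 1] s1 by simp
    qed
    show ?thesis using has_integral_combine[OF _ _ low high] s0 by simp
  qed
qed

text \<open>This identifies the convolution with the closed formula: a centre is near the lower line, near the
  upper line, or, on an interval of length \<open>a - 2\<close>, out of reach of both.\<close>

lemma limit_cdf_decomposition:
  assumes "0 < a"
  shows "2 * edge_integral mu t + (a - 2) * axis_cdf mu t = a * limit_cdf (1 / a) mu t"
  using assms by (auto simp: edge_integral_def axis_cdf_def limit_cdf_def field_simps)

lemma has_integral_axis_cdf_hit_prob:
  assumes "2 \<le> a"
  shows "((\<lambda>x. axis_cdf mu (t - hit_prob a x)) has_integral a * limit_cdf (1 / a) mu t) {0..a}"
proof -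
  let ?f = "\<lambda>x. axis_cdf mu (t - hit_prob a x)"
  have left: "(?f has_integral edge_integral mu t) {0..1}"
  proof (rule has_integral_eq[OF _ has_integral_axis_cdf_arccos])
    fix x :: real assume "x \<in> {0..1}"
    then have "max 0 (min 1 (min x (a - x))) = x" using assms by auto
    then show "axis_cdf mu (t - arccos x / pi) = ?f x" by (simp only: hit_prob_def)
  qed
  have "((\<lambda>x. ?f (- x)) has_integral edge_integral mu t) {- 1..0}"
    using left by (subst has_integral_reflect_real[of _ _ 1 0, simplified]) simp
  then have "(((\<lambda>x. ?f (- x)) \<circ> (+) (- a)) has_integral edge_integral mu t) {a - 1..a}"
    by (subst has_integral_shift_Icc_real) simp
  moreover have "(\<lambda>x. ?f (- x)) \<circ> (+) (- a) = ?f"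
    by (rule ext) (simp add: hit_prob_def min.commute)
  ultimately have right: "(?f has_integral edge_integral mu t) {a - 1..a}"
    by (simp only:)
  have mid: "(?f has_integral (a - 2) * axis_cdf mu t) {1..a - 1}"
  proof (rule has_integral_eq)
    show "((\<lambda>x. axis_cdf mu t) has_integral (a - 2) * axis_cdf mu t) {1..a - 1}"
      using has_integral_const_real[of "axis_cdf mu t" 1 "a - 1"] assms by simp
    fix x assume "x \<in> {1..a - 1}"
    then have "max 0 (min 1 (min x (a - x))) = 1" using assms by auto
    then show "axis_cdf mu t = ?f x" by (simp only: hit_prob_def arccos_1) simp
  qed
  have "(?f has_integral (edge_integral mu t + (a - 2) * axis_cdf mu t) + edge_integral mu t) {0..a}"
    using assms
    by (intro has_integral_combine[OF _ _ has_integral_combine[OF _ _ left mid] right]) auto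
  then show ?thesis using limit_cdf_decomposition[of a mu t] assms by (simp add: algebra_simps)
qed

lemma prob_space_uniform_Icc:
  "0 < c \<Longrightarrow> prob_space (uniform_measure lborel {0..c::real})"
  by (rule prob_space_uniform_measure) auto

definition limit_distr :: "real \<Rightarrow> real \<Rightarrow> real measure" where
  "limit_distr a b = distr (uniform_measure lborel {0..a} \<Otimes>\<^sub>M uniform_measure lborel {0..b}) borel
     (\<lambda>(x, y). hit_prob a x + hit_prob b y)"

lemma real_distribution_limit_distr:
  assumes "0 < a" "0 < b"
  shows "real_distribution (limit_distr a b)"
proof -
  interpret A: prob_space "uniform_measure lborel {0..a}" by (rule prob_space_uniform_Icc) fact
  interpret B: prob_space "uniform_measure lborel {0..b}" by (rule prob_space_uniform_Icc) fact
  interpret pair_prob_space "uniform_measure lborel {0..a}" "uniform_measure lborel {0..b}" ..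
  show ?thesis unfolding limit_distr_def by (rule real_distribution_distr) measurable
qed

text \<open>By Tonelli, the probability that the sum is at most \<open>t\<close> is the average over \<open>x\<close> of the distribution
  function of the second summand at \<open>t - hit_prob a x\<close>.\<close>

lemma cdf_limit_distr:
  assumes "2 \<le> a" "2 \<le> b"
  shows "cdf (limit_distr a b) = limit_cdf (1 / a) (1 / b)"
proof
  fix t
  let ?A = "uniform_measure lborel {0..a}" and ?B = "uniform_measure lborel {0..b}"
  interpret A: prob_space ?A by (rule prob_space_uniform_Icc) (use assms in simp)
  interpret B: prob_space ?B by (rule prob_space_uniform_Icc) (use assms in simp)
  interpret pair_prob_space ?A ?B ..
  let ?I = "a * limit_cdf (1 / a) (1 / b) t"
  let ?S = "{(x, y). hit_prob a x + hit_prob b y \<le> t}"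
  note int = has_integral_axis_cdf_hit_prob[OF assms(1), of "1 / b" t]
  have nonneg: "0 \<le> axis_cdf (1 / b) s" for s using assms by (intro axis_cdf_nonneg) auto
  have I: "0 \<le> ?I" using has_integral_nonneg[OF int] nonneg by simp
  have S: "?S = {p \<in> space (?A \<Otimes>\<^sub>M ?B). hit_prob a (fst p) + hit_prob b (snd p) \<le> t}"
    by (auto simp: space_pair_measure)
  have S_sets [measurable]: "?S \<in> sets (?A \<Otimes>\<^sub>M ?B)" unfolding S by measurable
  have "emeasure (?A \<Otimes>\<^sub>M ?B) ?S = (\<integral>\<^sup>+x. emeasure ?B (Pair x -` ?S) \<partial>?A)"
    by (rule B.emeasure_pair_measure_alt[OF S_sets])
  also have "\<dots> = (\<integral>\<^sup>+x. ennreal (axis_cdf (1 / b) (t - hit_prob a x)) \<partial>?A)"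
  proof (rule nn_integral_cong)
    fix x
    have "Pair x -` ?S = {y. hit_prob b y \<le> t - hit_prob a x}" by auto
    then show "emeasure ?B (Pair x -` ?S) = ennreal (axis_cdf (1 / b) (t - hit_prob a x))"
      using measure_hit_prob_le[OF assms(2), of "t - hit_prob a x"] by (simp add: B.emeasure_eq_measure)
  qed
  also have "\<dots> = (\<integral>\<^sup>+x. ennreal (axis_cdf (1 / b) (t - hit_prob a x)) * indicator {0..a} x \<partial>lborel) / ennreal a"
    using assms by (subst nn_integral_uniform_measure) auto
  also have "\<dots> = ennreal ?I / ennreal a"
    using nn_integral_has_integral_lebesgue'[OF _ int] nonneg by simp
  also have "\<dots> = ennreal (limit_cdf (1 / a) (1 / b) t)"
    using assms I by (subst divide_ennreal) auto
  finally have "measure (?A \<Otimes>\<^sub>M ?B) ?S = limit_cdf (1 / a) (1 / b) t"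
    using I assms by (simp add: measure_def zero_le_mult_iff)
  moreover have "cdf (limit_distr a b) t = measure (?A \<Otimes>\<^sub>M ?B) ?S"
    unfolding cdf_def limit_distr_def
    by (subst measure_distr) (auto intro!: arg_cong2[where f = measure] simp: space_pair_measure)
  ultimately show "cdf (limit_distr a b) t = limit_cdf (1 / a) (1 / b) t" by simp
qed

section \<open>Concentration around the conditional mean\<close>

text \<open>The centred number of lines met by one needle; centring is conditional on the position
  \<open>(x, y)\<close> of the centre.\<close>

definition deviation :: "real \<Rightarrow> real \<Rightarrow> real \<Rightarrow> real \<Rightarrow> real \<Rightarrow> real" where
  "deviation a b x y t = of_bool (crosses a x (cos t)) + of_bool (crosses b y (sin t)) - (hit_prob a x + hit_prob b y)"

lemma deviation_measurable [measurable]: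
  assumes [measurable]: "f \<in> borel_measurable M" "g \<in> borel_measurable M" "h \<in> borel_measurable M"
  shows "(\<lambda>w. deviation a b (f w) (g w) (h w)) \<in> borel_measurable M"
  unfolding deviation_def by measurable

lemma abs_deviation_le: "\<bar>deviation a b x y t\<bar> \<le> 2"
  using hit_prob_bounds[of a x] hit_prob_bounds[of b y] by (auto simp: deviation_def of_bool_def)

lemma integral_deviation:
  assumes "2 \<le> a" "2 \<le> b" "0 < x" "x < a" "x \<noteq> 1" "0 < y" "y < b" "y \<noteq> 1"
  shows "(\<integral>t. deviation a b x y t \<partial>uniform_measure lborel {0..2 * pi}) = 0"
proof -
  let ?U = "uniform_measure lborel {0..2 * pi}"
  interpret U: prob_space ?U by (rule prob_space_uniform_Icc) simp
  have x: "measure ?U {t. crosses a x (cos t)} = hit_prob a x"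
    using assms by (intro measure_crosses measure_arcs) auto
  have y: "measure ?U {t. crosses b y (sin t)} = hit_prob b y"
    using assms by (intro measure_crosses measure_arcs) auto
  have int: "integrable ?U (\<lambda>t. of_bool (P t) :: real)" "(\<integral>t. of_bool (P t) \<partial>?U) = measure ?U {t. P t}"
    if [measurable]: "Measurable.pred borel P" for P
  proof -
    have ind: "(\<lambda>t. of_bool (P t) :: real) = indicator {t. P t}" by (auto simp: fun_eq_iff)
    show "integrable ?U (\<lambda>t. of_bool (P t) :: real)"
      by (rule U.integrable_const_bound[where B = 1]) auto
    show "(\<integral>t. of_bool (P t) \<partial>?U) = measure ?U {t. P t}"
      unfolding ind by simp
  qed
  have "(\<integral>t. deviation a b x y t \<partial>?U)
      = measure ?U {t. crosses a x (cos t)} + measure ?U {t. crosses b y (sin t)} - (hit_prob a x + hit_prob b y)"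
    unfolding deviation_def using U.prob_space by (simp add: int)
  then show ?thesis by (simp add: x y)
qed

context random_throw
begin

abbreviation mean_share :: "'w \<Rightarrow> real" where
  "mean_share \<omega> \<equiv> hit_prob a (x \<omega>) + hit_prob b (y \<omega>)"

definition variate :: "coordinate \<Rightarrow> 'w \<Rightarrow> real" where
  "variate k = (case k of Abscissa \<Rightarrow> x | Ordinate \<Rightarrow> y | Angle i \<Rightarrow> \<phi> i)"

lemma variate_simps [simp]: "variate Abscissa = x" "variate Ordinate = y" "variate (Angle i) = \<phi> i"
  by (simp_all add: variate_def)

lemma indep_variates: "indep_vars (\<lambda>_. borel) variate ({Abscissa, Ordinate} \<union> Angle ` {1..n})"
proof -
  have "variate = (\<lambda>k. case k of Abscissa \<Rightarrow> x | Ordinate \<Rightarrow> y | Angle i \<Rightarrow> \<phi> i)"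
    by (simp add: variate_def fun_eq_iff)
  then show ?thesis using independent by simp
qed

lemma variate_measurable:
  "k \<in> {Abscissa, Ordinate} \<union> Angle ` {1..n} \<Longrightarrow> random_variable borel (variate k)"
  using indep_variates unfolding indep_vars_def by blast

lemma x_measurable [measurable]: "random_variable borel x"
  using variate_measurable[of Abscissa] by simp

lemma y_measurable [measurable]: "random_variable borel y"
  using variate_measurable[of Ordinate] by simp

lemma angle_measurable: "i \<in> {1..n} \<Longrightarrow> random_variable borel (\<phi> i)"
  using variate_measurable[of "Angle i"] by simp

lemma indep_x_y: "indep_var borel x borel y"
proof -
  have "indep_var borel ((\<lambda>w. w Abscissa) \<circ> (\<lambda>\<omega>. \<lambda>k\<in>{Abscissa}. variate k \<omega>))
      borel ((\<lambda>w. w Ordinate) \<circ> (\<lambda>\<omega>. \<lambda>k\<in>{Ordinate}. variate k \<omega>))"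
    by (rule indep_var_compose[OF indep_var_restrict[OF indep_variates]]) auto
  then show ?thesis by (simp add: o_def)
qed

text \<open>The conditional mean of the share has the same law for every \<open>n\<close>, and this law is the limit.\<close>

lemma distr_mean_share: "distr M borel mean_share = limit_distr a b"
proof -
  have "uniform_measure lborel {0..a} \<Otimes>\<^sub>M uniform_measure lborel {0..b}
      = distr M (borel \<Otimes>\<^sub>M borel) (\<lambda>\<omega>. (x \<omega>, y \<omega>))"
    using indep_x_y unfolding indep_var_distribution_eq x_uniform y_uniform by simp
  then show ?thesis
    unfolding limit_distr_def by (simp add: distr_distr o_def)
qed

text \<open>The excluded values are those at which the geometric description of the crossings
  degenerates: a centre on a line, or at distance exactly \<open>1\<close> from a line.\<close>

lemma AE_centre:
  assumes "2 \<le> a" "2 \<le> b"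
  shows "AE \<omega> in M. 0 < x \<omega> \<and> x \<omega> < a \<and> x \<omega> \<noteq> 1 \<and> x \<omega> \<noteq> a - 1 \<and>
    0 < y \<omega> \<and> y \<omega> < b \<and> y \<omega> \<noteq> 1 \<and> y \<omega> \<noteq> b - 1"
proof -
  have *: "AE \<omega> in M. 0 < z \<omega> \<and> z \<omega> < c \<and> z \<omega> \<noteq> 1 \<and> z \<omega> \<noteq> c - 1"
    if [measurable]: "random_variable borel z" and z: "distr M borel z = uniform_measure lborel {0..c}"
    for z :: "'w \<Rightarrow> real" and c :: real
  proof -
    have "AE u in uniform_measure lborel {0..c}. 0 < u \<and> u < c \<and> u \<noteq> 1 \<and> u \<noteq> c - 1"
    proof (rule AE_uniform_measureI)
      show "AE u in lborel. u \<in> {0..c} \<longrightarrow> 0 < u \<and> u < c \<and> u \<noteq> 1 \<and> u \<noteq> c - 1"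
        using AE_lborel_singleton[of 0] AE_lborel_singleton[of c] AE_lborel_singleton[of 1] AE_lborel_singleton[of "c - 1"]
        by eventually_elim auto
    qed simp
    then have "AE u in distr M borel z. 0 < u \<and> u < c \<and> u \<noteq> 1 \<and> u \<noteq> c - 1" by (simp only: z)
    then show ?thesis by (subst (asm) AE_distr_iff) auto
  qed
  show ?thesis
    using *[OF x_measurable x_uniform] *[OF y_measurable y_uniform] by eventually_elim auto
qed

abbreviation dev :: "nat \<Rightarrow> 'w \<Rightarrow> real" where
  "dev i \<omega> \<equiv> deviation a b (x \<omega>) (y \<omega>) (\<phi> i \<omega>)"

lemma deviation_product_integrable:
  assumes "i \<in> {1..n}" "j \<in> {1..n}"
  shows "integrable M (\<lambda>\<omega>. dev i \<omega> * dev j \<omega>)"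
proof (rule integrable_const_bound[where B = 4])
  note [measurable] = assms[THEN angle_measurable]
  show "(\<lambda>\<omega>. dev i \<omega> * dev j \<omega>) \<in> borel_measurable M" by measurable
  have "norm (dev i \<omega> * dev j \<omega>) \<le> 4" for \<omega>
  proof -
    have "\<bar>dev i \<omega>\<bar> * \<bar>dev j \<omega>\<bar> \<le> 2 * 2" by (intro mult_mono abs_deviation_le) auto
    then show ?thesis by (simp add: abs_mult)
  qed
  then show "AE \<omega> in M. norm (dev i \<omega> * dev j \<omega>) \<le> 4" by simp
qed

text \<open>Given the centre, the directions of two different needles are independent, and each deviation
  has conditional mean zero. The conditioning is carried out by Fubini: the tuple of centre and \<open>i\<close>-th
  angle is independent of the \<open>j\<close>-th angle, and integrating out the latter already gives zero.\<close>

lemma deviations_uncorrelated: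
  assumes "2 \<le> a" "2 \<le> b" "i \<in> {1..n}" "j \<in> {1..n}" "i \<noteq> j"
  shows "expectation (\<lambda>\<omega>. dev i \<omega> * dev j \<omega>) = 0"
proof -
  note [measurable] = assms(3,4)[THEN angle_measurable]
  define A B where "A = {Abscissa, Ordinate, Angle i}" and "B = {Angle j}"
  \<comment> \<open>As functions of the coordinate, both tuples are restrictions of one independent family.\<close>
  define R where "R K \<omega> = (\<lambda>k\<in>K. variate k \<omega>)" for K :: "coordinate set" and \<omega>
  let ?PA = "PiM A (\<lambda>_. borel :: real measure)" and ?PB = "PiM B (\<lambda>_. borel :: real measure)"
  let ?k = "\<lambda>(s, q). deviation a b (s Abscissa) (s Ordinate) (s (Angle i))
                   * deviation a b (s Abscissa) (s Ordinate) (q (Angle j))"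
  have ind: "indep_var ?PA (R A) ?PB (R B)"
    unfolding R_def by (rule indep_var_restrict[OF indep_variates]) (use assms in \<open>auto simp: A_def B_def\<close>)
  note RA [measurable] = indep_var_rv1[OF ind] and RB [measurable] = indep_var_rv2[OF ind]
  have prod: "distr M (?PA \<Otimes>\<^sub>M ?PB) (\<lambda>\<omega>. (R A \<omega>, R B \<omega>)) = distr M ?PA (R A) \<Otimes>\<^sub>M distr M ?PB (R B)"
    using ind unfolding indep_var_distribution_eq by simp
  interpret A: prob_space "distr M ?PA (R A)" by (rule prob_space_distr) (rule RA)
  interpret B: prob_space "distr M ?PB (R B)" by (rule prob_space_distr) (rule RB)
  interpret P: pair_prob_space "distr M ?PA (R A)" "distr M ?PB (R B)" ..
  have R: "R A \<omega> Abscissa = x \<omega>" "R A \<omega> Ordinate = y \<omega>" "R A \<omega> (Angle i) = \<phi> i \<omega>"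
    "R B \<omega> (Angle j) = \<phi> j \<omega>" for \<omega>
    by (simp_all add: R_def A_def B_def)
  have comp [measurable]: "(\<lambda>s. s Abscissa) \<in> borel_measurable ?PA" "(\<lambda>s. s Ordinate) \<in> borel_measurable ?PA"
    "(\<lambda>s. s (Angle i)) \<in> borel_measurable ?PA" "(\<lambda>q. q (Angle j)) \<in> borel_measurable ?PB"
    by (rule measurable_component_singleton; simp add: A_def B_def)+
  have k [measurable]: "?k \<in> borel_measurable (?PA \<Otimes>\<^sub>M ?PB)"
    unfolding case_prod_beta
    by (intro borel_measurable_times deviation_measurable
        measurable_compose[OF measurable_fst comp(1)] measurable_compose[OF measurable_fst comp(2)]
        measurable_compose[OF measurable_fst comp(3)] measurable_compose[OF measurable_snd comp(4)])
  have int: "integrable (distr M ?PA (R A) \<Otimes>\<^sub>M distr M ?PB (R B)) ?k"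
    unfolding prod[symmetric]
  proof (subst integrable_distr_eq)
    show "integrable M (\<lambda>\<omega>. ?k (R A \<omega>, R B \<omega>))"
      using deviation_product_integrable[OF assms(3,4)] by (simp add: R)
  qed measurable
  have "expectation (\<lambda>\<omega>. dev i \<omega> * dev j \<omega>) = expectation (\<lambda>\<omega>. ?k (R A \<omega>, R B \<omega>))"
    by (simp add: R)
  also have "\<dots> = integral\<^sup>L (distr M (?PA \<Otimes>\<^sub>M ?PB) (\<lambda>\<omega>. (R A \<omega>, R B \<omega>))) ?k"
    by (rule integral_distr[symmetric]) measurable
  also have "\<dots> = (\<integral>s. (\<integral>q. ?k (s, q) \<partial>distr M ?PB (R B)) \<partial>distr M ?PA (R A))"
    unfolding prod using int by (rule P.integral_fst'[symmetric])
  also have "\<dots> = expectation (\<lambda>\<omega>. \<integral>q. ?k (R A \<omega>, q) \<partial>distr M ?PB (R B))"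
  proof (rule integral_distr[OF RA])
    show "(\<lambda>s. \<integral>q. ?k (s, q) \<partial>distr M ?PB (R B)) \<in> borel_measurable ?PA"
      by (rule B.borel_measurable_lebesgue_integral) (simp add: k)
  qed
  also have "\<dots> = 0"
  proof (rule integral_eq_zero_AE)
    show "AE \<omega> in M. (\<integral>q. ?k (R A \<omega>, q) \<partial>distr M ?PB (R B)) = 0"
      using AE_centre[OF assms(1,2)]
    proof eventually_elim
      case (elim \<omega>)
      have "(\<integral>q. ?k (R A \<omega>, q) \<partial>distr M ?PB (R B))
          = dev i \<omega> * (\<integral>q. deviation a b (x \<omega>) (y \<omega>) (q (Angle j)) \<partial>distr M ?PB (R B))"
        by (simp add: R)
      also have "(\<integral>q. deviation a b (x \<omega>) (y \<omega>) (q (Angle j)) \<partial>distr M ?PB (R B))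
          = expectation (\<lambda>\<omega>'. deviation a b (x \<omega>) (y \<omega>) (\<phi> j \<omega>'))"
        by (subst integral_distr[OF RB]) (simp_all add: R)
      also have "\<dots> = (\<integral>t. deviation a b (x \<omega>) (y \<omega>) t \<partial>distr M borel (\<phi> j))"
        by (rule integral_distr[symmetric]) measurable
      also have "\<dots> = 0"
        unfolding angle_uniform[OF assms(4)] using assms(1,2) elim by (intro integral_deviation) auto
      finally show ?case by simp
    qed
  qed
  finally show ?thesis .
qed

abbreviation share :: "'w \<Rightarrow> real" where
  "share \<equiv> relative_intersections a b n x y \<phi>"

lemma share_eq:
  assumes "2 \<le> a" "2 \<le> b"
  shows "share \<omega> = (\<Sum>i\<in>{1..n}. of_bool (crosses a (x \<omega>) (cos (\<phi> i \<omega>))) + of_bool (crosses b (y \<omega>) (sin (\<phi> i \<omega>)))) / real n"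
  by (simp add: relative_intersections_def cluster_intersections_def needle_intersections_eq[OF assms])

lemma share_measurable:
  assumes "2 \<le> a" "2 \<le> b"
  shows "random_variable borel share"
proof -
  note [measurable] = angle_measurable
  have "(\<lambda>\<omega>. (\<Sum>i\<in>{1..n}. of_bool (crosses a (x \<omega>) (cos (\<phi> i \<omega>))) + of_bool (crosses b (y \<omega>) (sin (\<phi> i \<omega>))))
      / real n) \<in> borel_measurable M"
    by measurable
  then show ?thesis by (simp only: share_eq[OF assms, abs_def])
qed

lemma share_deviation:
  assumes "2 \<le> a" "2 \<le> b" "1 \<le> n"
  shows "share \<omega> - mean_share \<omega> = (\<Sum>i\<in>{1..n}. dev i \<omega>) / real n"
  using assms(3) by (simp add: share_eq[OF assms(1,2)] deviation_def sum_subtractf diff_divide_distrib)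

text \<open>The weak law of large numbers conditional on the centre. Only the \<open>n\<close> diagonal terms of the
  second moment of the sum of deviations survive, each at most \<open>2^2\<close>.\<close>

lemma prob_share_far_from_mean:
  assumes "2 \<le> a" "2 \<le> b" "1 \<le> n" "0 < e"
  shows "prob {\<omega> \<in> space M. e \<le> \<bar>share \<omega> - mean_share \<omega>\<bar>} \<le> 4 / (real n * e\<^sup>2)"
proof -
  note [measurable] = share_measurable[OF assms(1,2)]
  have sq: "(share \<omega> - mean_share \<omega>)\<^sup>2 = (\<Sum>i\<in>{1..n}. \<Sum>j\<in>{1..n}. dev i \<omega> * dev j \<omega>) / (real n)\<^sup>2" for \<omega>
    by (simp only: share_deviation[OF assms(1-3)] power_divide power2_eq_square[of "sum _ _"] sum_product)
  have int: "integrable M (\<lambda>\<omega>. \<Sum>i\<in>{1..n}. \<Sum>j\<in>{1..n}. dev i \<omega> * dev j \<omega>)"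
    by (intro Bochner_Integration.integrable_sum deviation_product_integrable)
  have le: "expectation (\<lambda>\<omega>. dev i \<omega> * dev j \<omega>) \<le> (if i = j then 4 else 0)"
    if "i \<in> {1..n}" "j \<in> {1..n}" for i j
  proof (cases "i = j")
    case True
    have "dev i \<omega> * dev j \<omega> \<le> 4" for \<omega>
      using abs_deviation_le[of a b "x \<omega>" "y \<omega>" "\<phi> i \<omega>"] abs_le_square_iff[of "dev i \<omega>" 2] True
      by (simp add: power2_eq_square)
    then have "expectation (\<lambda>\<omega>. dev i \<omega> * dev j \<omega>) \<le> expectation (\<lambda>\<omega>. 4)"
      using that by (intro integral_mono deviation_product_integrable) auto
    then show ?thesis using True by (simp add: prob_space)
  next
    case False
    then show ?thesis using deviations_uncorrelated[OF assms(1,2) that] by simp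
  qed
  have "expectation (\<lambda>\<omega>. \<Sum>i\<in>{1..n}. \<Sum>j\<in>{1..n}. dev i \<omega> * dev j \<omega>)
      = (\<Sum>i\<in>{1..n}. \<Sum>j\<in>{1..n}. expectation (\<lambda>\<omega>. dev i \<omega> * dev j \<omega>))"
    by (subst Bochner_Integration.integral_sum)
      (auto intro!: sum.cong Bochner_Integration.integral_sum Bochner_Integration.integrable_sum
        deviation_product_integrable)
  also have "\<dots> \<le> (\<Sum>i\<in>{1..n}. \<Sum>j\<in>{1..n}. if i = j then 4 else 0)"
    by (intro sum_mono le)
  also have "\<dots> = 4 * real n" by simp
  finally have var: "expectation (\<lambda>\<omega>. (share \<omega> - mean_share \<omega>)\<^sup>2) \<le> 4 * real n / (real n)\<^sup>2"
    unfolding sq by (simp add: divide_right_mono)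
  have "prob {\<omega> \<in> space M. e \<le> \<bar>share \<omega> - mean_share \<omega>\<bar>}
      \<le> expectation (\<lambda>\<omega>. (share \<omega> - mean_share \<omega>)\<^sup>2) / e\<^sup>2"
  proof (rule second_moment_method)
    show "integrable M (\<lambda>\<omega>. (share \<omega> - mean_share \<omega>)\<^sup>2)"
      unfolding sq using int by simp
  qed (use assms in auto)
  also have "\<dots> \<le> (4 * real n / (real n)\<^sup>2) / e\<^sup>2"
    using var by (intro divide_right_mono) auto
  also have "\<dots> = 4 / (real n * e\<^sup>2)"
    using assms by (simp add: power2_eq_square)
  finally show ?thesis .
qed

lemma prob_mean_share_le:
  assumes "2 \<le> a" "2 \<le> b"
  shows "prob {\<omega> \<in> space M. mean_share \<omega> \<le> s} = limit_cdf (1 / a) (1 / b) s"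
proof -
  have "limit_cdf (1 / a) (1 / b) s = measure (distr M borel mean_share) {..s}"
    by (simp only: cdf_limit_distr[OF assms, symmetric] distr_mean_share cdf_def)
  also have "\<dots> = prob {\<omega> \<in> space M. mean_share \<omega> \<le> s}"
    by (subst measure_distr) (auto intro!: arg_cong2[where f = measure])
  finally show ?thesis by simp
qed

lemma prob_share_le_upper:
  assumes "2 \<le> a" "2 \<le> b" "1 \<le> n" "0 < e"
  shows "prob {\<omega> \<in> space M. share \<omega> \<le> t} \<le> limit_cdf (1 / a) (1 / b) (t + e) + 4 / (real n * e\<^sup>2)"
proof -
  note [measurable] = share_measurable[OF assms(1,2)]
  have "prob {\<omega> \<in> space M. share \<omega> \<le> t}
      \<le> prob ({\<omega> \<in> space M. mean_share \<omega> \<le> t + e} \<union> {\<omega> \<in> space M. e \<le> \<bar>share \<omega> - mean_share \<omega>\<bar>})"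
    by (intro finite_measure_mono) auto
  also have "\<dots> \<le> prob {\<omega> \<in> space M. mean_share \<omega> \<le> t + e}
      + prob {\<omega> \<in> space M. e \<le> \<bar>share \<omega> - mean_share \<omega>\<bar>}"
    by (rule measure_Un_le) measurable
  finally show ?thesis
    using prob_share_far_from_mean[OF assms] prob_mean_share_le[OF assms(1,2), of "t + e"] by linarith
qed

lemma prob_share_le_lower:
  assumes "2 \<le> a" "2 \<le> b" "1 \<le> n" "0 < e"
  shows "limit_cdf (1 / a) (1 / b) (t - e) - 4 / (real n * e\<^sup>2) \<le> prob {\<omega> \<in> space M. share \<omega> \<le> t}"
proof -
  note [measurable] = share_measurable[OF assms(1,2)]
  have "prob {\<omega> \<in> space M. mean_share \<omega> \<le> t - e}
      \<le> prob ({\<omega> \<in> space M. share \<omega> \<le> t} \<union> {\<omega> \<in> space M. e \<le> \<bar>share \<omega> - mean_share \<omega>\<bar>})"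
    by (intro finite_measure_mono) auto
  also have "\<dots> \<le> prob {\<omega> \<in> space M. share \<omega> \<le> t}
      + prob {\<omega> \<in> space M. e \<le> \<bar>share \<omega> - mean_share \<omega>\<bar>}"
    by (rule measure_Un_le) measurable
  finally show ?thesis
    using prob_share_far_from_mean[OF assms] prob_mean_share_le[OF assms(1,2), of "t - e"] by linarith
qed

text \<open>The limit distribution function may jump at \<open>0\<close>, so that the comparison with its value slightly to the
  left gives nothing there. Instead, a vanishing conditional mean forces all lines to be out of reach, and then
  the share itself vanishes.\<close>

lemma prob_share_eq_0_lower:
  assumes "2 \<le> a" "2 \<le> b"
  shows "limit_cdf (1 / a) (1 / b) 0 \<le> prob {\<omega> \<in> space M. share \<omega> \<le> 0}"
proof -
  note [measurable] = share_measurable[OF assms]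
  have far: "\<not> crosses c z d"
    if "hit_prob c z \<le> 0" "2 \<le> c" "0 < z" "z < c" "z \<noteq> 1" "z \<noteq> c - 1" "\<bar>d\<bar> \<le> 1" for c z d
  proof -
    have "1 \<le> max 0 (min 1 (min z (c - z)))"
      using that(1) arccos_over_pi_le_iff[of 0 "max 0 (min 1 (min z (c - z)))"] by (simp add: hit_prob_def)
    then show ?thesis using that by (subst crosses_iff) auto
  qed
  have "prob {\<omega> \<in> space M. mean_share \<omega> \<le> 0} \<le> prob {\<omega> \<in> space M. share \<omega> \<le> 0}"
  proof (rule finite_measure_mono_AE)
    show "AE \<omega> in M. \<omega> \<in> {\<omega> \<in> space M. mean_share \<omega> \<le> 0} \<longrightarrow> \<omega> \<in> {\<omega> \<in> space M. share \<omega> \<le> 0}"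
      using AE_centre[OF assms]
    proof eventually_elim
      case (elim \<omega>)
      show ?case
      proof safe
        assume "mean_share \<omega> \<le> 0"
        then have "hit_prob a (x \<omega>) \<le> 0" "hit_prob b (y \<omega>) \<le> 0"
          using hit_prob_bounds(1)[of a "x \<omega>"] hit_prob_bounds(1)[of b "y \<omega>"] by linarith+
        then have "\<not> crosses a (x \<omega>) (cos t)" "\<not> crosses b (y \<omega>) (sin t)" for t
          using far[of a "x \<omega>" "cos t"] far[of b "y \<omega>" "sin t"] elim assms by auto
        then show "share \<omega> \<le> 0" by (simp add: share_eq[OF assms])
      qed
    qed
  qed measurable
  then show ?thesis by (simp only: prob_mean_share_le[OF assms])
qed

lemma share_nonneg: "0 \<le> share \<omega>"
  by (simp add: relative_intersections_def)

end

section \<open>Convergence of the distribution functions\<close>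

lemma continuous_on_limit_cdf: "continuous_on {0..} (limit_cdf lam mu)"
proof -
  let ?c1 = "\<lambda>x. 1 - 2 * (lam + mu) * cos (pi * x) + 2 * (2 * cos (pi * x) - pi * x * sin (pi * x)) * lam * mu"
  let ?c2 = "\<lambda>x. 1 + 2 * pi * (x - 1) * lam * mu * sin (pi * x)"
  have join: "?c1 x = ?c2 x" if x: "x = 1 / 2" for x
  proof -
    have "pi * x = pi / 2" using x by simp
    then have half: "cos (pi * x) = 0" "sin (pi * x) = 1" by (simp_all only: cos_pi_half sin_pi_half)
    show ?thesis unfolding half unfolding x by simp
  qed
  have "continuous_on {0..} (\<lambda>x. if x \<le> 1 / 2 then ?c1 x else if x \<le> 1 then ?c2 x else 1)"
  proof (rule continuous_on_cases_le)
    show "continuous_on {x \<in> {0..}. x \<le> 1 / 2} ?c1" by (intro continuous_intros)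
    have "continuous_on {1 / 2..} (\<lambda>x. if x \<le> 1 then ?c2 x else 1)"
      by (rule continuous_on_cases_le) (auto intro!: continuous_intros)
    moreover have "{x \<in> {0..}. 1 / 2 \<le> x} = {1 / 2 :: real..}" by auto
    ultimately show "continuous_on {x \<in> {0..}. 1 / 2 \<le> x} (\<lambda>x. if x \<le> 1 then ?c2 x else 1)" by simp
    show "continuous_on {0..} (\<lambda>x::real. x)" by (rule continuous_on_id)
    show "?c1 x = (if x \<le> 1 then ?c2 x else 1)" if "x = 1 / 2" for x
      unfolding join[OF that] using that by simp
  qed
  then show ?thesis
  proof (rule continuous_on_eq)
    fix x :: real assume x: "x \<in> {0..}"
    show "(if x \<le> 1 / 2 then ?c1 x else if x \<le> 1 then ?c2 x else 1) = limit_cdf lam mu x"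
    proof (cases "x = 1 / 2")
      case True
      then have "(if x \<le> 1 / 2 then ?c1 x else if x \<le> 1 then ?c2 x else 1) = ?c1 x" by simp
      also have "\<dots> = ?c2 x" by (rule join[OF True])
      also have "\<dots> = limit_cdf lam mu x" using True by (simp add: limit_cdf_def)
      finally show ?thesis .
    next
      case False
      then show ?thesis using x by (cases "x = 1") (auto simp: limit_cdf_def)
    qed
  qed
qed

text \<open>The argument of Polya. Monotonicity controls a function between
  neighbouring points of a fine grid by its values on the grid, and there are only finitely many grid
  points. A jump of the limit at \<open>0\<close> is harmless because all functions agree to the left of it.\<close>

lemma uniform_convergence_of_monotone:
  fixes F :: "nat \<Rightarrow> real \<Rightarrow> real" and G :: "real \<Rightarrow> real"
  assumes monoF: "\<And>n. 1 \<le> n \<Longrightarrow> mono (F n)"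
    and F0: "\<And>n t. 1 \<le> n \<Longrightarrow> t < 0 \<Longrightarrow> F n t = 0" and G0: "\<And>t. t < 0 \<Longrightarrow> G t = 0"
    and F1: "\<And>n t. 1 \<le> n \<Longrightarrow> F n t \<le> 1" and G1: "\<And>t. 1 \<le> t \<Longrightarrow> G t = 1"
    and cont: "continuous_on {0..1} G"
    and conv: "\<And>t. t \<in> {0..1} \<Longrightarrow> (\<lambda>n. F n t) \<longlonglongrightarrow> G t"
  shows "(\<lambda>n. SUP t. \<bar>F n t - G t\<bar>) \<longlonglongrightarrow> 0"
proof (rule LIMSEQ_I)
  fix r :: real assume "0 < r"
  define e where "e = r / 4"
  have e: "0 < e" "2 * e < r" using \<open>0 < r\<close> by (auto simp: e_def)
  have "uniformly_continuous_on {0..1} G" by (rule compact_uniformly_continuous[OF cont]) simp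
  then obtain d where d: "0 < d" "\<And>s t. s \<in> {0..1} \<Longrightarrow> t \<in> {0..1} \<Longrightarrow> dist t s < d \<Longrightarrow> dist (G t) (G s) < e"
    using e(1) unfolding uniformly_continuous_on_def by metis
  obtain m :: nat where m: "1 / d < real m" using reals_Archimedean2 by blast
  have m0: "0 < real m" using m d(1) by (smt (verit) divide_pos_pos)
  have md: "1 / real m < d" using m m0 d(1) by (simp add: field_simps)
  have "\<forall>\<^sub>F n in sequentially. \<bar>F n (real k / real m) - G (real k / real m)\<bar> < e" if "k \<in> {..m}" for k
  proof -
    have "real k / real m \<in> {0..1}" using that m0 by simp
    from tendstoD[OF conv[OF this] e(1)] show ?thesis by (simp add: dist_real_def)
  qed
  then have "\<forall>\<^sub>F n in sequentially. \<forall>k\<in>{..m}. \<bar>F n (real k / real m) - G (real k / real m)\<bar> < e"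
    by (intro eventually_ball_finite) auto
  then obtain N where N: "\<And>n k. N \<le> n \<Longrightarrow> k \<le> m \<Longrightarrow> \<bar>F n (real k / real m) - G (real k / real m)\<bar> < e"
    unfolding eventually_sequentially by auto
  show "\<exists>no. \<forall>n\<ge>no. norm ((SUP t. \<bar>F n t - G t\<bar>) - 0) < r"
  proof (intro exI[of _ "max N 1"] allI impI)
    fix n assume "max N 1 \<le> n"
    then have n: "N \<le> n" "1 \<le> n" by auto
    have bound: "\<bar>F n t - G t\<bar> \<le> 2 * e" for t
    proof -
      consider "t < 0" | "0 \<le> t" "t < 1" | "1 \<le> t" by linarith
      then show ?thesis
      proof cases
        case 1
        then show ?thesis using F0[OF n(2)] G0 e by simp
      next
        case 3
        have "F n 1 \<le> F n t" using monoF[OF n(2)] 3 by (rule monoD)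
        moreover have "\<bar>F n 1 - G 1\<bar> < e" using N[OF n(1), of m] m0 by simp
        moreover have "G 1 = 1" "G t = 1" using G1 3 by auto
        moreover have "F n t \<le> 1" by (rule F1[OF n(2)])
        ultimately show ?thesis using e by linarith
      next
        case 2
        \<comment> \<open>The grid cell \<open>[k / m, (k + 1) / m]\<close> contains \<open>t\<close>.\<close>
        define k where "k = nat \<lfloor>t * real m\<rfloor>"
        have k: "real k \<le> t * real m" "t * real m < real k + 1"
          using 2 m0 by (auto simp: k_def)
        have "t * real m < 1 * real m" using 2 m0 by (intro mult_strict_right_mono) auto
        then have km: "k + 1 \<le> m" using k by linarith
        define p q where "p = real k / real m" and "q = real (k + 1) / real m"
        have pt: "p \<le> t" and tq: "t \<le> q" and qp: "q - p = 1 / real m"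
          using k m0 by (auto simp: p_def q_def field_simps)
        have pq: "p \<in> {0..1}" "q \<in> {0..1}" using km m0 by (auto simp: p_def q_def)
        have t01: "t \<in> {0..1}" using 2 by simp
        have "F n p \<le> F n t" "F n t \<le> F n q" using monoF[OF n(2)] pt tq by (auto dest: monoD)
        moreover have "\<bar>F n p - G p\<bar> < e" "\<bar>F n q - G q\<bar> < e"
          using N[OF n(1), of k] N[OF n(1), of "k + 1"] km unfolding p_def q_def by linarith+
        moreover have "dist (G t) (G p) < e"
          by (rule d(2)[OF pq(1) t01]) (use pt tq qp md in \<open>simp add: dist_real_def\<close>)
        moreover have "dist (G t) (G q) < e"
          by (rule d(2)[OF pq(2) t01]) (use pt tq qp md in \<open>simp add: dist_real_def\<close>)
        ultimately show ?thesis unfolding dist_real_def by linarith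
      qed
    qed
    have "(SUP t. \<bar>F n t - G t\<bar>) \<le> 2 * e" by (rule cSUP_least) (use bound in auto)
    moreover have "\<bar>F n 0 - G 0\<bar> \<le> (SUP t. \<bar>F n t - G t\<bar>)"
      by (rule cSUP_upper) (auto intro!: bdd_aboveI2 bound)
    ultimately show "norm ((SUP t. \<bar>F n t - G t\<bar>) - 0) < r" using e by simp
  qed
qed

text \<open>Apart from the Chebyshev error, the distribution function of the share lies between the limit
  at \<open>t - e\<close> and at \<open>t + e\<close>, and the limit is continuous on \<open>[0, \<infinity>)\<close>.\<close>

lemma tendsto_share_cdf:
  fixes M :: "nat \<Rightarrow> 'w measure"
  assumes ab: "2 \<le> a" "2 \<le> b"
    and throw: "\<And>n. 1 \<le> n \<Longrightarrow> random_throw (M n) a b n (x n) (y n) (\<phi> n)"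
    and F: "\<And>n t. 1 \<le> n \<Longrightarrow>
      F n t = measure (M n) {\<omega> \<in> space (M n). relative_intersections a b n (x n) (y n) (\<phi> n) \<omega> \<le> t}"
    and t: "0 \<le> t"
  shows "(\<lambda>n. F n t) \<longlonglongrightarrow> limit_cdf (1 / a) (1 / b) t"
proof (rule LIMSEQ_I)
  let ?G = "limit_cdf (1 / a) (1 / b)"
  fix r :: real assume r: "0 < r"
  obtain d where d: "0 < d" "\<And>s. 0 \<le> s \<Longrightarrow> dist s t < d \<Longrightarrow> dist (?G s) (?G t) < r / 2"
    using continuous_on_limit_cdf[of "1 / a" "1 / b"] t r
    unfolding continuous_on_iff by (metis atLeast_iff half_gt_zero)
  \<comment> \<open>For positive \<open>t\<close> the point \<open>t - e\<close> must not fall below \<open>0\<close>, where the limit may jump.\<close>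
  define e where "e = (if t = 0 then d / 2 else min (d / 2) t)"
  have e: "0 < e" "e < d" "t \<noteq> 0 \<Longrightarrow> e \<le> t" using d(1) t by (auto simp: e_def)
  have "(\<lambda>n. 4 / (real n * e\<^sup>2)) \<longlonglongrightarrow> 0"
  proof -
    have "(\<lambda>n. 4 / e\<^sup>2 * inverse (real n)) \<longlonglongrightarrow> 4 / e\<^sup>2 * 0"
      by (intro tendsto_intros lim_inverse_n)
    then show ?thesis by (simp add: field_simps)
  qed
  then have "\<forall>\<^sub>F n in sequentially. 4 / (real n * e\<^sup>2) < r / 2"
    using r by (intro order_tendstoD(2)[where y = 0]) auto
  then obtain N where N: "\<And>n. N \<le> n \<Longrightarrow> 4 / (real n * e\<^sup>2) < r / 2"
    unfolding eventually_sequentially by blast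
  show "\<exists>no. \<forall>n\<ge>no. norm (F n t - ?G t) < r"
  proof (intro exI[of _ "max N 1"] allI impI)
    fix n assume "max N 1 \<le> n"
    then have n: "N \<le> n" "1 \<le> n" by auto
    interpret random_throw "M n" a b n "x n" "y n" "\<phi> n" by (rule throw) fact
    have "F n t \<le> ?G (t + e) + 4 / (real n * e\<^sup>2)"
      using prob_share_le_upper[OF ab n(2) e(1), of t] by (simp add: F[OF n(2)])
    moreover have "dist (?G (t + e)) (?G t) < r / 2" using t e by (intro d(2)) (auto simp: dist_real_def)
    moreover have "?G t - r / 2 - 4 / (real n * e\<^sup>2) \<le> F n t"
    proof (cases "t = 0")
      case True
      have "?G t \<le> F n t" using prob_share_eq_0_lower[OF ab] by (simp add: F[OF n(2)] True)
      moreover have "0 \<le> 4 / (real n * e\<^sup>2)" by simp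
      ultimately show ?thesis using r by linarith
    next
      case False
      have "?G (t - e) - 4 / (real n * e\<^sup>2) \<le> F n t"
        using prob_share_le_lower[OF ab n(2) e(1), of t] by (simp add: F[OF n(2)])
      moreover have "dist (?G (t - e)) (?G t) < r / 2"
        using t e(1,2) e(3)[OF False] by (intro d(2)) (auto simp: dist_real_def)
      ultimately show ?thesis unfolding dist_real_def by linarith
    qed
    ultimately show "norm (F n t - ?G t) < r"
      using N[OF n(1)] unfolding dist_real_def real_norm_def by linarith
  qed
qed

theorem mainTheorem1:
  fixes a b lam mu :: real
    and M :: "nat \<Rightarrow> 'w measure"
    and x y :: "nat \<Rightarrow> 'w \<Rightarrow> real"
    and \<phi> :: "nat \<Rightarrow> nat \<Rightarrow> 'w \<Rightarrow> real"
    and X :: "nat \<Rightarrow> 'w \<Rightarrow> real"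
    and F :: "nat \<Rightarrow> real \<Rightarrow> real"
  assumes "min a b \<ge> 2"
    and "lam = 1 / a" and "mu = 1 / b"
    and "\<And>n. n \<ge> 1 \<Longrightarrow> random_throw (M n) a b n (x n) (y n) (\<phi> n)"
    and "\<And>n. n \<ge> 1 \<Longrightarrow> X n = relative_intersections a b n (x n) (y n) (\<phi> n)"
    and "\<And>n t. n \<ge> 1 \<Longrightarrow> F n t = measure (M n) {\<omega> \<in> space (M n). X n \<omega> \<le> t}"
  shows "(\<forall>n\<ge>1. X n \<in> borel_measurable (M n)) \<and>
    (\<exists>N. real_distribution N \<and> cdf N = limit_cdf lam mu \<and>
         weak_conv_m (\<lambda>n. distr (M n) borel (X n)) N) \<and>
    (\<lambda>n. SUP t. \<bar>F n t - limit_cdf lam mu t\<bar>) \<longlonglongrightarrow> 0"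
proof -
  have ab: "2 \<le> a" "2 \<le> b" using assms(1) by auto
  note throw = assms(4) and X = assms(5)
  let ?G = "limit_cdf (1 / a) (1 / b)"
  let ?N = "limit_distr a b"
  have G: "limit_cdf lam mu = ?G" by (simp only: assms(2,3))
  have meas: "X n \<in> borel_measurable (M n)" if "1 \<le> n" for n
    using random_throw.share_measurable[OF throw[OF that] ab] by (simp only: X[OF that])
  have F: "F n t = measure (M n) {\<omega> \<in> space (M n). relative_intersections a b n (x n) (y n) (\<phi> n) \<omega> \<le> t}"
    if "1 \<le> n" for n t
    using assms(6)[OF that] by (simp only: X[OF that])
  interpret N: real_distribution ?N using ab by (intro real_distribution_limit_distr) auto
  have cdfN: "cdf ?N = ?G" by (rule cdf_limit_distr[OF ab])
  have monoF: "mono (F n)" if n: "1 \<le> n" for n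
  proof
    interpret random_throw "M n" a b n "x n" "y n" "\<phi> n" by (rule throw) fact
    fix s t :: real assume "s \<le> t"
    then show "F n s \<le> F n t"
      unfolding assms(6)[OF n] using meas[OF n] by (intro finite_measure_mono) auto
  qed
  have F0: "F n t = 0" if "1 \<le> n" "t < 0" for n t
  proof -
    interpret random_throw "M n" a b n "x n" "y n" "\<phi> n" by (rule throw) fact
    have "\<not> share \<omega> \<le> t" for \<omega> using share_nonneg[of \<omega>] that by linarith
    then show ?thesis by (simp add: F[OF that(1)])
  qed
  have F1: "F n t \<le> 1" if "1 \<le> n" for n t
  proof -
    interpret random_throw "M n" a b n "x n" "y n" "\<phi> n" by (rule throw) fact
    show ?thesis by (simp add: F[OF that])
  qed
  have conv: "(\<lambda>n. F n t) \<longlonglongrightarrow> ?G t" for t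
  proof (cases "0 \<le> t")
    case True
    show ?thesis by (rule tendsto_share_cdf[OF ab throw F True])
  next
    case False
    then have "\<forall>\<^sub>F n in sequentially. F n t = ?G t"
      using F0[of _ t] by (auto simp: eventually_sequentially limit_cdf_def intro!: exI[of _ 1])
    then show ?thesis by (rule tendsto_eventually)
  qed
  have "(\<lambda>n. cdf (distr (M n) borel (X n)) t) \<longlonglongrightarrow> ?G t" for t
  proof (rule Lim_transform_eventually[OF conv])
    have "F n t = cdf (distr (M n) borel (X n)) t" if "1 \<le> n" for n
      unfolding assms(6)[OF that] cdf_def using meas[OF that]
      by (subst measure_distr) (auto intro!: arg_cong2[where f = measure])
    then show "\<forall>\<^sub>F n in sequentially. F n t = cdf (distr (M n) borel (X n)) t"
      unfolding eventually_sequentially by blast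
  qed
  then have weak: "weak_conv_m (\<lambda>n. distr (M n) borel (X n)) ?N"
    by (simp add: weak_conv_m_def weak_conv_def cdfN)
  have unif: "(\<lambda>n. SUP t. \<bar>F n t - ?G t\<bar>) \<longlonglongrightarrow> 0"
  proof (rule uniform_convergence_of_monotone[OF monoF F0 _ F1])
    show "continuous_on {0..1} ?G" by (rule continuous_on_subset[OF continuous_on_limit_cdf]) auto
    show "\<And>t. (\<lambda>n. F n t) \<longlonglongrightarrow> ?G t" by (rule conv)
  qed (auto simp: limit_cdf_def)
  show ?thesis
    unfolding G using meas N.real_distribution_axioms cdfN weak unif by blast
qed

end
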